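(* Let $(A,B)$ be a single-state generalized recursive game with termination constant $t>0$ (termination fee $-t<0$). Suppose that some mixed strategy $x$ of player 1 has the following property: there are constants $\alpha_0\ge 0$ and $0<\varepsilon<t$ such that, for every mixed strategy $y$ of player 2, the associated quantities $\alpha=x^{T}Ay$ and $\beta=x^{T}By$ satisfy $$\alpha\ge \alpha_0,\qquad \beta\ge 0,\qquad \alpha\ge t(\beta-1)+\varepsilon .$$ Then for every $n\ge 0$ the expected return $\underline V_n$ that player 1 can force in the $n$-truncated game satisfies $$\underline V_n\ \ge\ v_n:=\alpha_0-\alpha_0\Big(1-\frac{\varepsilon}{t}\Big)^{\max\{0,n-1\}}-t\Big(1-\frac{\varepsilon}{t}\Big)^n ,$$ that is, the strategy can force a payoff with lower bound converging exponentially to $\alpha_0$. Moreover, the value $\underline V$ forcible by player 1 is the smallest fixed point of the value map $T$ that is greater than or equal to $-t$, and it is greater than or equal to $\alpha_0$.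
   Context: A (finite) single-state generalized recursive game is given by two real $m\times k$ matrices $A,B$ with $B_{ij}\ge 0$: if player 1 uses pure strategy $i$ and player 2 uses pure strategy $j$, then $A_{ij}$ is the expected immediate (one-shot) return to player 1 (player 2 receives $-A_{ij}$) and $B_{ij}$ is the expected stakes multiplier with which the same game is then replayed (the sum over all events of the probability of replaying times the stakes of the replayed game). Mixed strategies $x,y$ are probability vectors in $\mathbb R^m,\mathbb R^k$. For a real matrix $M$, $\mathrm{Value}(M)=\max_x\min_y x^{T}My=\min_y\max_x x^TMy$ over mixed strategies. The value map is $T(V)=\mathrm{Value}(A+BV)$. A player may stop the game before natural termination by paying a fee equal to $t$ times the current stakes. In the $n$-truncated game play must stop (naturally or by payment of the fee) at stage at most $n$. The payoff $\underline V_n$ that player 1 can force in the $n$-truncated game is given by $\underline V_0=-t$, $\underline V_{n+1}=T(\underline V_n)$, and $\underline V:=\sup_{n\ge0}\underline V_n$. The value $+\infty$ is allowed for $\underline V$ and for fixed points, with $T(+\infty):=\lim_{V\to+\infty}T(V)$. *)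

theory Defs
  imports "HOL-Analysis.Analysis"
begin

definition mixed :: "(real ^ 'n) set" where
  "mixed = {x. (\<forall>i. 0 \<le> x $ i) \<and> (\<Sum>i\<in>UNIV. x $ i) = 1}"

text \<open>Maxmin over mixed strategies. Lemmas \<open>game_value_saddle\<close> and \<open>game_value_minimax\<close> below
  show that supremum and infimum are attained and that the minmax gives the same number.\<close>

definition game_value :: "real ^ 'k ^ 'm \<Rightarrow> real" where
  "game_value M = (SUP x\<in>mixed. INF y\<in>mixed. x \<bullet> (M *v y))"

text \<open>\<open>A\<close> holds the expected immediate returns to player 1 and \<open>B\<close> the expected stakes
  multipliers with which the same game is replayed.\<close>

definition value_map :: "real ^ 'k ^ 'm \<Rightarrow> real ^ 'k ^ 'm \<Rightarrow> real \<Rightarrow> real" where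
  "value_map A B V = game_value (A + V *\<^sub>R B)"

text \<open>The value map on \<open>(-\<infinity>, \<infinity>]\<close>; its value at \<open>-\<infinity>\<close> carries no meaning.\<close>

definition value_map_ext :: "real ^ 'k ^ 'm \<Rightarrow> real ^ 'k ^ 'm \<Rightarrow> ereal \<Rightarrow> ereal" where
  "value_map_ext A B W =
     (if W = \<infinity> then Lim at_top (\<lambda>V. ereal (value_map A B V))
      else ereal (value_map A B (real_of_ereal W)))"

text \<open>The payoff player 1 can force when play must stop, at the latest after \<open>n\<close> stages, by
  payment of the fee \<open>t\<close> times the current stakes.\<close>

primrec lower_trunc :: "real ^ 'k ^ 'm \<Rightarrow> real ^ 'k ^ 'm \<Rightarrow> real \<Rightarrow> nat \<Rightarrow> real" where
  "lower_trunc A B t 0 = - t"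
| "lower_trunc A B t (Suc n) = value_map A B (lower_trunc A B t n)"

definition lower_value :: "real ^ 'k ^ 'm \<Rightarrow> real ^ 'k ^ 'm \<Rightarrow> real \<Rightarrow> ereal" where
  "lower_value A B t = (SUP n. ereal (lower_trunc A B t n))"

text \<open>What player 1 secures in the \<open>n\<close>-truncated game by using the fixed mixed strategy \<open>x\<close> at
  every stage and paying the fee at the end: the recursion for \<open>lower_trunc\<close> with the maximisation
  over \<open>x\<close> removed.\<close>

primrec strategy_trunc ::
  "real ^ 'k ^ 'm \<Rightarrow> real ^ 'k ^ 'm \<Rightarrow> real \<Rightarrow> real ^ 'm \<Rightarrow> nat \<Rightarrow> real" where
  "strategy_trunc A B t x 0 = - t"
| "strategy_trunc A B t x (Suc n) =
     (INF y\<in>mixed. x \<bullet> ((A + strategy_trunc A B t x n *\<^sub>R B) *v y))"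

text \<open>Subtraction on \<open>nat\<close> truncates, so the exponent \<open>n - 1\<close> is \<open>max {0, n - 1}\<close>.\<close>

definition lower_bound :: "real \<Rightarrow> real \<Rightarrow> real \<Rightarrow> nat \<Rightarrow> real" where
  "lower_bound \<alpha>\<^sub>0 \<epsilon> t n =
     \<alpha>\<^sub>0 - \<alpha>\<^sub>0 * (1 - \<epsilon> / t) ^ (n - 1) - t * (1 - \<epsilon> / t) ^ n"


subsection \<open>The value of a matrix game is well defined\<close>

lemma axis_in_mixed: "axis i 1 \<in> mixed"
  by (auto simp: mixed_def axis_def)

lemma mixed_nonempty: "mixed \<noteq> {}"
  using axis_in_mixed by blast

lemma convex_mixed: "convex mixed"
  unfolding mixed_def convex_def
  by (auto simp: sum.distrib simp flip: sum_distrib_left)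

lemma compact_mixed: "compact (mixed :: (real ^ 'n) set)"
proof -
  have "closed (mixed :: (real ^ 'n) set)"
    unfolding mixed_def
    by (intro closed_Collect_conj closed_Collect_all closed_Collect_le closed_Collect_eq
        continuous_intros)
  moreover have "norm x \<le> 1" if "x \<in> mixed" for x :: "real ^ 'n"
    using norm_le_l1_cart[of x] that by (simp add: mixed_def)
  then have "bounded (mixed :: (real ^ 'n) set)"
    by (auto simp: bounded_iff)
  ultimately show ?thesis
    by (simp add: compact_eq_bounded_closed)
qed

lemma mixed_inner_le:
  assumes "x \<in> mixed" "\<And>i. z $ i \<le> v" shows "x \<bullet> z \<le> v"
proof -
  have "x \<bullet> z \<le> (\<Sum>i\<in>UNIV. x $ i * v)"
    unfolding inner_vec_def using assms
    by (auto simp: mixed_def intro!: sum_mono mult_left_mono)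
  also have "\<dots> = v" using assms by (simp add: mixed_def flip: sum_distrib_right)
  finally show ?thesis .
qed

lemma closed_upper_levels:
  fixes M :: "real ^ 'k ^ 'm"
  shows "closed {v. \<exists>y\<in>mixed. \<forall>i. (M *v y) $ i \<le> v}"
proof -
  have "closed (fst -` mixed :: ((real ^ 'k) \<times> real) set)"
    using compact_imp_closed[OF compact_mixed] by (intro closed_vimage continuous_intros) auto
  moreover have "closed {p :: (real ^ 'k) \<times> real. \<forall>i. (M *v fst p) $ i \<le> snd p}"
    unfolding matrix_vector_mult_def
    by (intro closed_Collect_all closed_Collect_le) (auto intro!: continuous_intros)
  ultimately have "closed (fst -` mixed \<inter> {p :: (real ^ 'k) \<times> real. \<forall>i. (M *v fst p) $ i \<le> snd p})"
    by (rule closed_Int)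
  from closed_compact_projection[OF compact_mixed this] show ?thesis
    by (simp add: Bex_def)
qed

lemma matrix_game_alternative:
  fixes M :: "real ^ 'k ^ 'm"
  assumes "\<not> (\<exists>y\<in>mixed. \<forall>i. (M *v y) $ i \<le> v)"
  shows "\<exists>x\<in>mixed. \<forall>y\<in>mixed. v \<le> x \<bullet> (M *v y)"
proof -
  let ?C = "(*v) M ` mixed" and ?D = "{z :: real ^ 'm. \<forall>i. z $ i \<le> v}"
  have "convex ?C"
    by (intro convex_linear_image convex_mixed) simp
  moreover have "compact ?C"
    by (intro compact_continuous_image compact_mixed linear_continuous_on
        matrix_vector_mul_bounded_linear)
  moreover have "convex ?D"
    by (auto simp: convex_def intro: convex_bound_le)
  moreover have "closed ?D"
    by (intro closed_Collect_all closed_Collect_le continuous_intros)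
  moreover have "?C \<inter> ?D = {}" using assms by auto
  ultimately obtain a b where C: "\<forall>z\<in>?C. a \<bullet> z < b" and D: "\<forall>z\<in>?D. a \<bullet> z > b"
    using separating_hyperplane_compact_closed[of ?C ?D] mixed_nonempty by blast
  have a: "a $ i \<le> 0" for i
  proof (rule ccontr)
    assume "\<not> a $ i \<le> 0"
    then have pos: "a $ i > 0" by simp
    define d where "d = max 0 ((a \<bullet> vec v - b) / (a $ i))"
    have "vec v - d *\<^sub>R axis i 1 \<in> ?D" by (auto simp: d_def axis_def)
    with D have "b < a \<bullet> (vec v - d *\<^sub>R axis i 1)" by blast
    then have "b < a \<bullet> vec v - d * a $ i"
      by (simp add: inner_diff_right inner_axis)
    moreover have "(a \<bullet> vec v - b) / (a $ i) \<le> d" by (simp add: d_def)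
    then have "a \<bullet> vec v - b \<le> d * a $ i" using pos by (simp add: pos_divide_le_eq)
    ultimately show False by simp
  qed
  define s where "s = (\<Sum>i\<in>UNIV. - a $ i)"
  have "b < a \<bullet> vec v" using D by simp
  moreover obtain y0 :: "real ^ 'k" where "y0 \<in> mixed" using mixed_nonempty by blast
  then have "a \<bullet> (M *v y0) < b" using C by blast
  ultimately have "a \<noteq> 0" by auto
  then obtain i where "a $ i \<noteq> 0" by (auto simp: vec_eq_iff)
  then have "s > 0" unfolding s_def
    using a by (intro sum_pos2[of _ i]) (auto simp: less_le)
  define x where "x = (- 1 / s) *\<^sub>R a"
  have "x \<in> mixed"
    using a \<open>s > 0\<close>
    by (auto simp: mixed_def x_def s_def sum_negf divide_simps simp flip: sum_divide_distrib)
  moreover have "v \<le> x \<bullet> (M *v y)" if "y \<in> mixed" for y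
  proof -
    have "a \<bullet> vec v = - s * v"
      by (simp add: inner_vec_def s_def sum_negf flip: sum_distrib_right)
    moreover have "b < a \<bullet> vec v" using D by simp
    moreover have "a \<bullet> (M *v y) < b" using C that by blast
    ultimately have "a \<bullet> (M *v y) < - s * v" by simp
    then show ?thesis using \<open>s > 0\<close> by (simp add: x_def field_simps)
  qed
  ultimately show ?thesis by blast
qed

lemma saddle_point_exists:
  fixes M :: "real ^ 'k ^ 'm"
  obtains v x y where "x \<in> mixed" "y \<in> mixed"
    "\<And>y'. y' \<in> mixed \<Longrightarrow> v \<le> x \<bullet> (M *v y')" "\<And>x'. x' \<in> mixed \<Longrightarrow> x' \<bullet> (M *v y) \<le> v"
proof -
  define U where "U = {v. \<exists>y\<in>mixed. \<forall>i. (M *v y) $ i \<le> v}"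
  define L where "L = {w. \<exists>x\<in>mixed. \<forall>j. (- transpose M *v x) $ j \<le> w}"
  have L_iff: "w \<in> L \<longleftrightarrow> (\<exists>x\<in>mixed. \<forall>y\<in>mixed. - w \<le> x \<bullet> (M *v y))" for w
  proof -
    have eq: "y \<bullet> (- transpose M *v x) = - (x \<bullet> (M *v y))" for x y
    proof -
      have "y \<bullet> (- transpose M *v x) = - (y \<bullet> (transpose M *v x))"
        by (simp add: inner_vec_def matrix_vector_mult_def sum_negf)
      also have "y \<bullet> (transpose M *v x) = x \<bullet> (M *v y)"
        by (metis dot_lmul_matrix inner_commute transpose_matrix_vector)
      finally show ?thesis .
    qed
    have "(\<forall>j. (- transpose M *v x) $ j \<le> w) \<longleftrightarrow> (\<forall>y\<in>mixed. y \<bullet> (- transpose M *v x) \<le> w)" for x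
      using mixed_inner_le[of _ "- transpose M *v x" w] axis_in_mixed
      by (metis inner_axis' mult_1 real_inner_1_left inner_real_def)
    then show ?thesis by (auto simp: L_def eq minus_le_iff)
  qed
  have U_iff: "v \<in> U \<longleftrightarrow> (\<exists>y\<in>mixed. \<forall>x\<in>mixed. x \<bullet> (M *v y) \<le> v)" for v
  proof -
    have "(\<forall>i. (M *v y) $ i \<le> v) \<longleftrightarrow> (\<forall>x\<in>mixed. x \<bullet> (M *v y) \<le> v)" for y
      using mixed_inner_le[of _ "M *v y" v] axis_in_mixed
      by (metis inner_axis' mult_1 real_inner_1_left inner_real_def)
    then show ?thesis by (auto simp: U_def)
  qed
  have "closed U" "closed L"
    unfolding U_def L_def by (rule closed_upper_levels)+
  obtain y0 :: "real ^ 'k" where "y0 \<in> mixed" using mixed_nonempty by blast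
  then have "Max (range (($) (M *v y0))) \<in> U"
    unfolding U_def by (intro CollectI bexI[of _ y0]) auto
  then have "U \<noteq> {}" by blast
  obtain x0 :: "real ^ 'm" where x0: "x0 \<in> mixed" using mixed_nonempty by blast
  then have "Max (range (($) (- transpose M *v x0))) \<in> L"
    unfolding L_def by (intro CollectI bexI[of _ x0]) auto
  then obtain w where "w \<in> L" by blast
  have LU: "- w \<le> v" if "w \<in> L" "v \<in> U" for v w
    using that unfolding L_iff U_iff by (meson order_trans)
  have bdd: "bdd_below U" using LU[OF \<open>w \<in> L\<close>] by (rule bdd_belowI)
  have "Inf U \<in> U"
    using closed_contains_Inf \<open>U \<noteq> {}\<close> bdd \<open>closed U\<close> by blast
  have inL: "w \<in> L" if "- w < Inf U" for w
  proof -
    have "- w \<notin> U" using that bdd by (meson cInf_lower leD)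
    then show ?thesis
      using matrix_game_alternative[of M "- w"] by (auto simp: U_def L_iff)
  qed
  have "- Inf U \<in> closure L"
    unfolding closure_approachable
  proof (intro allI impI)
    fix e :: real assume "e > 0"
    then show "\<exists>y\<in>L. dist y (- Inf U) < e"
      by (intro bexI[of _ "- Inf U + e / 2"] inL) (auto simp: dist_real_def)
  qed
  then have "- Inf U \<in> L" using \<open>closed L\<close> by simp
  with \<open>Inf U \<in> U\<close> show ?thesis
    unfolding U_iff L_iff minus_minus using that by blast
qed

lemma bilinear_bounded:
  fixes M :: "real ^ 'k ^ 'm"
  shows "\<exists>c. \<forall>x\<in>mixed. \<forall>y\<in>mixed. \<bar>x \<bullet> (M *v y)\<bar> \<le> c"
proof -
  have "compact ((\<lambda>p. fst p \<bullet> (M *v snd p)) ` (mixed \<times> mixed))"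
    by (intro compact_continuous_image compact_Times compact_mixed continuous_on_inner
        continuous_on_fst continuous_on_id continuous_on_compose2[OF linear_continuous_on[OF matrix_vector_mul_bounded_linear]] continuous_on_snd) auto
  then have "bounded ((\<lambda>p. fst p \<bullet> (M *v snd p)) ` (mixed \<times> mixed))"
    by (rule compact_imp_bounded)
  then show ?thesis by (fastforce simp: bounded_iff)
qed

lemma saddle_values:
  fixes M :: "real ^ 'k ^ 'm"
  assumes x: "x \<in> mixed" and y: "y \<in> mixed"
    and lo: "\<And>y'. y' \<in> mixed \<Longrightarrow> v \<le> x \<bullet> (M *v y')"
    and up: "\<And>x'. x' \<in> mixed \<Longrightarrow> x' \<bullet> (M *v y) \<le> v"
  shows "game_value M = v" "(INF y\<in>mixed. SUP x\<in>mixed. x \<bullet> (M *v y)) = v"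
proof -
  obtain c where c: "\<And>x y. x \<in> mixed \<Longrightarrow> y \<in> mixed \<Longrightarrow> \<bar>x \<bullet> (M *v y)\<bar> \<le> c"
    using bilinear_bounded[of M] by blast
  have bb: "bdd_below ((\<lambda>y. x' \<bullet> (M *v y)) ` mixed)" if "x' \<in> mixed" for x'
    using c[OF that] by (intro bdd_belowI2[of _ "- c"]) (auto simp: abs_le_iff minus_le_iff)
  have ba: "bdd_above ((\<lambda>x. x \<bullet> (M *v y')) ` mixed)" if "y' \<in> mixed" for y'
    using c[OF _ that] by (intro bdd_aboveI2[of _ _ c]) (auto simp: abs_le_iff)
  have le: "(INF y\<in>mixed. x' \<bullet> (M *v y)) \<le> v" if "x' \<in> mixed" for x'
    using cINF_lower[OF bb[OF that] y] up[OF that] by linarith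
  have ge: "v \<le> (SUP x\<in>mixed. x \<bullet> (M *v y'))" if "y' \<in> mixed" for y'
    using cSUP_upper[OF x ba[OF that]] lo[OF that] by linarith
  show "game_value M = v"
    unfolding game_value_def
  proof (rule antisym)
    have "v \<le> (INF y\<in>mixed. x \<bullet> (M *v y))"
      using lo mixed_nonempty by (intro cINF_greatest) auto
    also have "\<dots> \<le> (SUP x\<in>mixed. INF y\<in>mixed. x \<bullet> (M *v y))"
      using le by (intro cSUP_upper x bdd_aboveI2[of _ _ v])
    finally show "v \<le> (SUP x\<in>mixed. INF y\<in>mixed. x \<bullet> (M *v y))" .
  qed (use le mixed_nonempty in \<open>auto intro: cSUP_least\<close>)
  show "(INF y\<in>mixed. SUP x\<in>mixed. x \<bullet> (M *v y)) = v"
  proof (rule antisym)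
    have "(INF y\<in>mixed. SUP x\<in>mixed. x \<bullet> (M *v y)) \<le> (SUP x\<in>mixed. x \<bullet> (M *v y))"
      using ge by (intro cINF_lower y bdd_belowI2[of _ v])
    also have "\<dots> \<le> v"
      using up mixed_nonempty by (intro cSUP_least) auto
    finally show "(INF y\<in>mixed. SUP x\<in>mixed. x \<bullet> (M *v y)) \<le> v" .
  qed (use ge mixed_nonempty in \<open>auto intro: cINF_greatest\<close>)
qed

lemma game_value_saddle:
  fixes M :: "real ^ 'k ^ 'm"
  obtains x y where "x \<in> mixed" "y \<in> mixed"
    "\<And>y'. y' \<in> mixed \<Longrightarrow> game_value M \<le> x \<bullet> (M *v y')"
    "\<And>x'. x' \<in> mixed \<Longrightarrow> x' \<bullet> (M *v y) \<le> game_value M"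
  using saddle_point_exists[of M] saddle_values(1)[of _ _ _ M] by metis

lemma game_value_minimax:
  fixes M :: "real ^ 'k ^ 'm"
  shows "game_value M = (INF y\<in>mixed. SUP x\<in>mixed. x \<bullet> (M *v y))"
  using saddle_point_exists[of M] saddle_values[of _ _ _ M] by metis

text \<open>The limit defining the value map at \<open>\<infinity>\<close> exists.\<close>

lemma value_map_mono:
  assumes "\<And>i j. 0 \<le> B $ i $ j" "V \<le> W"
  shows "value_map A B V \<le> value_map A B W"
proof -
  obtain x where x: "x \<in> mixed" "\<And>y. y \<in> mixed \<Longrightarrow> value_map A B V \<le> x \<bullet> ((A + V *\<^sub>R B) *v y)"
    unfolding value_map_def by (metis game_value_saddle)
  obtain y where y: "y \<in> mixed" "\<And>x. x \<in> mixed \<Longrightarrow> x \<bullet> ((A + W *\<^sub>R B) *v y) \<le> value_map A B W"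
    unfolding value_map_def by (metis game_value_saddle)
  have "0 \<le> x \<bullet> (B *v y)"
    using assms(1) x(1) y(1)
    by (auto simp: inner_vec_def matrix_vector_mult_def mixed_def intro!: sum_nonneg mult_nonneg_nonneg)
  then have "x \<bullet> ((A + V *\<^sub>R B) *v y) \<le> x \<bullet> ((A + W *\<^sub>R B) *v y)"
    using \<open>V \<le> W\<close>
    by (simp add: matrix_vector_mult_add_rdistrib inner_add_right mult_right_mono
        flip: scaleR_matrix_vector_assoc)
  with x(2)[OF y(1)] y(2)[OF x(1)] show ?thesis by linarith
qed

lemma value_map_ext_infinity:
  assumes "\<And>i j. 0 \<le> B $ i $ j"
  shows "((\<lambda>V. ereal (value_map A B V)) \<longlongrightarrow> value_map_ext A B \<infinity>) at_top"
proof -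
  let ?f = "\<lambda>V. ereal (value_map A B V)"
  have "(?f \<longlongrightarrow> (SUP V. ?f V)) at_top"
  proof (rule order_tendstoI)
    fix a assume "a < (SUP V. ?f V)"
    then obtain V where "a < ?f V" by (auto simp: less_SUP_iff)
    then show "\<forall>\<^sub>F W in at_top. a < ?f W"
      using value_map_mono[OF assms, of V]
      by (intro eventually_mono[OF eventually_ge_at_top[of V]])
        (meson ereal_less_eq(3) less_le_trans)
  next
    fix a assume "(SUP V. ?f V) < a"
    then show "\<forall>\<^sub>F W in at_top. ?f W < a"
      by (intro always_eventually allI) (meson SUP_upper UNIV_I le_less_trans)
  qed
  then show ?thesis
    unfolding value_map_ext_def by (simp add: tendsto_Lim)
qed

end

theory Submission imports Defs begin

text \<open>
  Write \<open>r = 1 - \<epsilon> / t\<close>. The hypothesis bounds the multiplier by \<open>\<beta> \<le> \<alpha> / t + r\<close>. If the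
  continuation of the game is worth \<open>v\<close> with \<open>- t \<le> v < 0\<close>, then one round played with \<open>x\<close> secures
  \<open>\<alpha> + \<beta> v \<ge> \<alpha> (1 + v / t) + r v \<ge> \<alpha>\<^sub>0 (1 + v / t) + r v\<close>: a large multiplier hurts, but it is
  always accompanied by a large immediate return. Since \<open>v \<ge> - t r ^ n\<close> for \<open>v = v\<^sub>n\<close>, this is
  at least \<open>v\<^sub>n\<^sub>+\<^sub>1\<close>; and if \<open>v \<ge> 0\<close>, the round secures \<open>\<alpha>\<^sub>0\<close> outright
  (\<open>lower_bound_step\<close>). Induction gives the exponential bound, both for the fixed strategy \<open>x\<close> and,
  because the value of a matrix game dominates whatever one strategy secures, for the optimal
  truncated play.

  The fixed point statements are Kleene iteration. The bound at \<open>n = 1\<close> gives \<open>T (- t) \<ge> \<epsilon> - t\<close>, so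
  monotonicity of \<open>T\<close> makes the truncated values increase, hence converge to their supremum. The
  value map is continuous, being Lipschitz at finite points (\<open>value_map_lipschitz\<close>) and a limit by
  construction at \<open>\<infinity>\<close>, so the supremum is a fixed point; monotonicity places every iterate below
  any other fixed point above \<open>- t\<close>.
\<close>

section \<open>The value map\<close>

lemma game_value_ge:
  assumes "x \<in> mixed" "\<And>y. y \<in> mixed \<Longrightarrow> c \<le> x \<bullet> (M *v y)"
  shows "c \<le> game_value M"
  using game_value_saddle[of M] assms by (metis order_trans)

lemma inner_pencil:
  fixes A B :: "real ^ 'k ^ 'm"
  shows "x \<bullet> ((A + V *\<^sub>R B) *v y) = x \<bullet> (A *v y) + x \<bullet> (B *v y) * V"
  by (simp add: matrix_vector_mult_add_rdistrib inner_add_right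
      flip: scaleR_matrix_vector_assoc)

text \<open>Play a strategy of player 1 that is optimal at \<open>W\<close> against one of player 2 that is optimal at
  \<open>V\<close>: the payoff is at least \<open>T W\<close> in the first game and at most \<open>T V\<close> in the second, and the two
  payoffs differ by \<open>(W - V) * (x \<bullet> (B *v y))\<close>.\<close>

lemma value_map_lipschitz:
  fixes A B :: "real ^ 'k ^ 'm"
  obtains c where "c-lipschitz_on UNIV (value_map A B)"
proof -
  obtain c where c: "\<And>x y. x \<in> mixed \<Longrightarrow> y \<in> mixed \<Longrightarrow> \<bar>x \<bullet> (B *v y)\<bar> \<le> c"
    using bilinear_bounded[of B] by blast
  have "0 \<le> c"
    using c[OF axis_in_mixed axis_in_mixed] abs_ge_zero order_trans by blast
  have le: "value_map A B W \<le> value_map A B V + c * \<bar>W - V\<bar>" for V W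
  proof -
    obtain x where x: "x \<in> mixed"
      "\<And>y. y \<in> mixed \<Longrightarrow> value_map A B W \<le> x \<bullet> ((A + W *\<^sub>R B) *v y)"
      unfolding value_map_def by (metis game_value_saddle)
    obtain y where y: "y \<in> mixed"
      "\<And>x. x \<in> mixed \<Longrightarrow> x \<bullet> ((A + V *\<^sub>R B) *v y) \<le> value_map A B V"
      unfolding value_map_def by (metis game_value_saddle)
    have "x \<bullet> (B *v y) * (W - V) \<le> \<bar>x \<bullet> (B *v y)\<bar> * \<bar>W - V\<bar>"
      by (metis abs_ge_self abs_mult)
    also have "\<dots> \<le> c * \<bar>W - V\<bar>"
      using c[OF x(1) y(1)] by (rule mult_right_mono) simp
    finally show ?thesis
      using x(2)[OF y(1)] y(2)[OF x(1)] by (simp add: inner_pencil right_diff_distrib)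
  qed
  have "\<bar>value_map A B W - value_map A B V\<bar> \<le> c * \<bar>W - V\<bar>" for V W
    using le[of W V] le[of V W] by (simp add: abs_le_iff abs_minus_commute)
  then have "c-lipschitz_on UNIV (value_map A B)"
    using \<open>0 \<le> c\<close> by (intro lipschitz_onI) (auto simp: dist_real_def)
  then show ?thesis by (rule that)
qed

lemma value_map_tendsto:
  assumes "(f \<longlongrightarrow> L) F"
  shows "((\<lambda>n. value_map A B (f n)) \<longlongrightarrow> value_map A B L) F"
proof -
  obtain c where "c-lipschitz_on UNIV (value_map A B)"
    by (rule value_map_lipschitz)
  then have "isCont (value_map A B) L"
    using lipschitz_on_continuous_on continuous_on_eq_continuous_at open_UNIV by blast
  then show ?thesis
    using assms by (rule isCont_tendsto_compose)
qed

section \<open>The bound secured by a fixed strategy\<close>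

text \<open>The truncated exponent \<open>n - 1\<close> only enters through the crude estimate \<open>v\<^sub>n \<ge> - t r ^ n\<close>, so the
  step from \<open>n = 0\<close> is no exception.\<close>

lemma lower_bound_step:
  assumes "0 < t" "0 \<le> \<alpha>\<^sub>0" "0 < \<epsilon>" "\<epsilon> < t"
    and "\<alpha>\<^sub>0 \<le> \<alpha>" "0 \<le> \<beta>" "t * (\<beta> - 1) + \<epsilon> \<le> \<alpha>"
    and s: "lower_bound \<alpha>\<^sub>0 \<epsilon> t n \<le> s"
  shows "lower_bound \<alpha>\<^sub>0 \<epsilon> t (Suc n) \<le> \<alpha> + \<beta> * s"
proof -
  define r where "r = 1 - \<epsilon> / t"
  define v where "v = lower_bound \<alpha>\<^sub>0 \<epsilon> t n"
  have r: "0 < r" "r < 1" using assms(1-4) by (auto simp: r_def)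
  have next_eq: "lower_bound \<alpha>\<^sub>0 \<epsilon> t (Suc n) = \<alpha>\<^sub>0 - \<alpha>\<^sub>0 * r ^ n - t * (r * r ^ n)"
    by (simp add: lower_bound_def r_def)
  have pow: "0 \<le> r ^ m" "r ^ m \<le> 1" for m using r by (auto intro: power_le_one)
  have "\<alpha>\<^sub>0 * r ^ (n - 1) \<le> \<alpha>\<^sub>0" using pow assms(2) by (simp add: mult_left_le)
  then have v_ge: "- (t * r ^ n) \<le> v" by (simp add: v_def lower_bound_def r_def)
  have "t * r ^ n \<le> t" using pow assms(1) by (simp add: mult_left_le)
  with v_ge have v_t: "- t \<le> v" by linarith
  have bs: "\<beta> * v \<le> \<beta> * s" using s assms(6) by (simp add: v_def mult_left_mono)
  show ?thesis
  proof (cases "0 \<le> v")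
    case True
    have "0 \<le> \<alpha>\<^sub>0 * r ^ n" "0 \<le> t * (r * r ^ n)" using pow r assms(1,2) by auto
    moreover have "0 \<le> \<beta> * v" using True assms(6) by simp
    ultimately show ?thesis using next_eq bs assms(5) by linarith
  next
    case False
    have "\<beta> \<le> \<alpha> / t + r" using assms(1,7) by (simp add: r_def field_simps)
    then have "(\<alpha> / t + r) * v \<le> \<beta> * v" using False by (intro mult_right_mono_neg) auto
    moreover have "\<alpha> + (\<alpha> / t + r) * v = \<alpha> * (1 + v / t) + r * v"
      by (simp add: algebra_simps)
    moreover have "\<alpha>\<^sub>0 * (1 + v / t) \<le> \<alpha> * (1 + v / t)"
      using assms(1,5) v_t by (intro mult_right_mono) (auto simp: field_simps)
    moreover have "- (r ^ n) \<le> v / t" using v_ge assms(1) by (simp add: field_simps)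
    then have "\<alpha>\<^sub>0 * (- (r ^ n)) \<le> \<alpha>\<^sub>0 * (v / t)" using assms(2) by (rule mult_left_mono)
    moreover have "r * (- (t * r ^ n)) \<le> r * v" using v_ge r by (intro mult_left_mono) auto
    ultimately show ?thesis using next_eq bs by (simp add: algebra_simps)
  qed
qed

text \<open>The factor \<open>\<alpha>\<^sub>0 / r\<close> pays for the exponent \<open>n - 1\<close>.\<close>

lemma lower_bound_exponential:
  assumes "0 < t" "0 \<le> \<alpha>\<^sub>0" "0 < \<epsilon>" "\<epsilon> < t"
  defines "r \<equiv> 1 - \<epsilon> / t"
  shows "\<bar>lower_bound \<alpha>\<^sub>0 \<epsilon> t n - \<alpha>\<^sub>0\<bar> \<le> (\<alpha>\<^sub>0 / r + t) * r ^ n"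
proof -
  have r: "0 < r" "r < 1" using assms(1-4) by (auto simp: r_def)
  have "r ^ (n - 1) \<le> r ^ n / r"
    using r by (cases n) auto
  then have "\<alpha>\<^sub>0 * r ^ (n - 1) \<le> \<alpha>\<^sub>0 / r * r ^ n"
    using mult_left_mono[OF _ assms(2)] by fastforce
  moreover have "\<bar>lower_bound \<alpha>\<^sub>0 \<epsilon> t n - \<alpha>\<^sub>0\<bar> = \<alpha>\<^sub>0 * r ^ (n - 1) + t * r ^ n"
  proof -
    have "0 \<le> \<alpha>\<^sub>0 * r ^ (n - 1)" "0 \<le> t * r ^ n" using r assms(1,2) by simp_all
    then show ?thesis by (simp add: lower_bound_def flip: r_def)
  qed
  ultimately show ?thesis by (simp add: distrib_right)
qed

lemma lower_bound_tendsto: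
  assumes "0 < t" "0 \<le> \<alpha>\<^sub>0" "0 < \<epsilon>" "\<epsilon> < t"
  shows "lower_bound \<alpha>\<^sub>0 \<epsilon> t \<longlonglongrightarrow> \<alpha>\<^sub>0"
proof -
  let ?r = "1 - \<epsilon> / t"
  have "(\<lambda>n. (\<alpha>\<^sub>0 / ?r + t) * ?r ^ n) \<longlonglongrightarrow> 0"
    using assms by (intro tendsto_mult_right_zero LIMSEQ_power_zero) auto
  then have "(\<lambda>n. lower_bound \<alpha>\<^sub>0 \<epsilon> t n - \<alpha>\<^sub>0) \<longlonglongrightarrow> 0"
    by (rule Lim_null_comparison[rotated])
      (use lower_bound_exponential[OF assms] in \<open>simp add: always_eventually\<close>)
  then show ?thesis by (simp add: LIM_zero_iff)
qed

section \<open>Iterating the value map from below\<close>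

lemma lower_trunc_incseq:
  assumes B: "\<And>i j. 0 \<le> B $ i $ j" and "- t \<le> value_map A B (- t)"
  shows "incseq (lower_trunc A B t)"
proof (rule incseq_SucI)
  fix n show "lower_trunc A B t n \<le> lower_trunc A B t (Suc n)"
    by (induction n) (use assms(2) value_map_mono[OF B] in auto)
qed

lemma lower_value_ge: "ereal (lower_trunc A B t n) \<le> lower_value A B t"
  unfolding lower_value_def by (rule SUP_upper) simp

text \<open>The shifted sequence of iterates converges to \<open>lower_value\<close> as a tail of the iteration, and to
  its image under the value map by continuity.\<close>

lemma lower_value_fixed_point:
  assumes B: "\<And>i j. 0 \<le> B $ i $ j" and "- t \<le> value_map A B (- t)"
  shows "value_map_ext A B (lower_value A B t) = lower_value A B t"
proof -
  let ?V = "lower_trunc A B t" and ?L = "lower_value A B t"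
  have "incseq (\<lambda>n. ereal (?V n))"
    using lower_trunc_incseq[OF assms] by (simp add: incseq_def)
  then have lim: "(\<lambda>n. ereal (?V n)) \<longlonglongrightarrow> ?L"
    unfolding lower_value_def by (rule LIMSEQ_SUP)
  have tail: "(\<lambda>n. ereal (value_map A B (?V n))) \<longlonglongrightarrow> ?L"
    using LIMSEQ_Suc[OF lim] by simp
  have "(\<lambda>n. ereal (value_map A B (?V n))) \<longlonglongrightarrow> value_map_ext A B ?L"
  proof (cases ?L)
    case (real l)
    then have "(\<lambda>n. value_map A B (?V n)) \<longlonglongrightarrow> value_map A B l"
      using lim by (intro value_map_tendsto) simp
    then show ?thesis by (simp add: real value_map_ext_def)
  next
    case PInf
    then have "filterlim ?V at_top sequentially"
      using lim by (simp add: tendsto_PInfty_eq_at_top)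
    with value_map_ext_infinity[OF B] show ?thesis
      unfolding PInf by (rule filterlim_compose)
  next
    case MInf
    then show ?thesis using lower_value_ge[of A B t 0] by simp
  qed
  then show ?thesis using tail by (rule LIMSEQ_unique)
qed

lemma lower_value_least:
  assumes B: "\<And>i j. 0 \<le> B $ i $ j"
    and fixed: "value_map_ext A B W = W" and "ereal (- t) \<le> W"
  shows "lower_value A B t \<le> W"
proof (cases W)
  case (real w)
  have "lower_trunc A B t n \<le> w" for n
  proof (induction n)
    case 0
    then show ?case using assms(3) real by simp
  next
    case (Suc n)
    have "value_map A B w = w" using fixed real by (simp add: value_map_ext_def)
    with value_map_mono[OF B Suc, of A] show ?case by simp
  qed
  then show ?thesis unfolding lower_value_def real by (intro SUP_least) simp
qed (use assms(3) in auto)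

theorem theorem4p8:
  fixes A B :: "real ^ 'k ^ 'm" and t \<alpha>\<^sub>0 \<epsilon> :: real and x :: "real ^ 'm"
  assumes "\<forall>i j. 0 \<le> B $ i $ j"
    and "0 < t"
    and "x \<in> mixed"
    and "0 \<le> \<alpha>\<^sub>0"
    and "0 < \<epsilon>" and "\<epsilon> < t"
    and "\<forall>y\<in>mixed. let \<alpha> = x \<bullet> (A *v y); \<beta> = x \<bullet> (B *v y)
           in \<alpha> \<ge> \<alpha>\<^sub>0 \<and> \<beta> \<ge> 0 \<and> \<alpha> \<ge> t * (\<beta> - 1) + \<epsilon>"
  shows "(\<forall>n. lower_trunc A B t n \<ge> lower_bound \<alpha>\<^sub>0 \<epsilon> t n)
    \<and> (\<forall>n. strategy_trunc A B t x n \<ge> lower_bound \<alpha>\<^sub>0 \<epsilon> t n)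
    \<and> (\<exists>C q. 0 \<le> q \<and> q < 1 \<and> (\<forall>n. \<bar>lower_bound \<alpha>\<^sub>0 \<epsilon> t n - \<alpha>\<^sub>0\<bar> \<le> C * q ^ n))
    \<and> value_map_ext A B (lower_value A B t) = lower_value A B t
    \<and> ereal (- t) \<le> lower_value A B t
    \<and> (\<forall>W. value_map_ext A B W = W \<and> ereal (- t) \<le> W \<longrightarrow> lower_value A B t \<le> W)
    \<and> ereal \<alpha>\<^sub>0 \<le> lower_value A B t"
proof -
  note params = assms(2,4,5,6)
  have B: "0 \<le> B $ i $ j" for i j using assms(1) by simp
  have round: "lower_bound \<alpha>\<^sub>0 \<epsilon> t (Suc n) \<le> x \<bullet> ((A + s *\<^sub>R B) *v y)"
    if "lower_bound \<alpha>\<^sub>0 \<epsilon> t n \<le> s" "y \<in> mixed" for n s y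
    unfolding inner_pencil
    using assms(7) that by (intro lower_bound_step[OF params]) (auto simp: Let_def)
  have zero: "lower_bound \<alpha>\<^sub>0 \<epsilon> t 0 = - t" by (simp add: lower_bound_def)
  have trunc: "lower_bound \<alpha>\<^sub>0 \<epsilon> t n \<le> lower_trunc A B t n" for n
  proof (induction n)
    case (Suc n)
    then show ?case
      by (simp add: value_map_def game_value_ge[OF assms(3)] round)
  qed (simp add: zero)
  have strategy: "lower_bound \<alpha>\<^sub>0 \<epsilon> t n \<le> strategy_trunc A B t x n" for n
  proof (induction n)
    case (Suc n)
    then show ?case
      by (auto intro!: cINF_greatest round simp: mixed_nonempty)
  qed (simp add: zero)
  have start: "- t \<le> value_map A B (- t)"
  proof -
    have "lower_bound \<alpha>\<^sub>0 \<epsilon> t 1 = - t + \<epsilon>"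
      using assms(2) by (simp add: lower_bound_def field_simps)
    then show ?thesis using trunc[of 1] assms(5) by simp
  qed
  have conv: "\<exists>C q. 0 \<le> q \<and> q < 1 \<and> (\<forall>n. \<bar>lower_bound \<alpha>\<^sub>0 \<epsilon> t n - \<alpha>\<^sub>0\<bar> \<le> C * q ^ n)"
  proof (intro exI conjI allI)
    show "\<bar>lower_bound \<alpha>\<^sub>0 \<epsilon> t n - \<alpha>\<^sub>0\<bar> \<le> (\<alpha>\<^sub>0 / (1 - \<epsilon> / t) + t) * (1 - \<epsilon> / t) ^ n" for n
      by (rule lower_bound_exponential[OF params])
  qed (use params in auto)
  have "ereal \<alpha>\<^sub>0 \<le> lower_value A B t"
  proof (rule LIMSEQ_le_const2)
    show "(\<lambda>n. ereal (lower_bound \<alpha>\<^sub>0 \<epsilon> t n)) \<longlonglongrightarrow> ereal \<alpha>\<^sub>0"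
      using lower_bound_tendsto[OF params] by simp
    show "\<exists>N. \<forall>n\<ge>N. ereal (lower_bound \<alpha>\<^sub>0 \<epsilon> t n) \<le> lower_value A B t"
      using trunc lower_value_ge by (meson ereal_less_eq(3) order_trans)
  qed
  moreover have "ereal (- t) \<le> lower_value A B t"
    using lower_value_ge[of A B t 0] by simp
  ultimately show ?thesis
    using trunc strategy conv lower_value_fixed_point[OF B start] lower_value_least[OF B] by blast
qed

end
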